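(* Let $F(w)=\frac1n\sum_{i=1}^n f_i(w)$ on $\mathbb{R}^d$, $n\ge 2$, be bounded below and $L$-average-smooth. Run mini-batch SARAH (defined in the context) with batch size $b\in\{1,\dots,n\}$, inner loop size $m$, outer loop size $S$, and learning rate $$0<\eta\le \frac{2}{L\left(\sqrt{1+\frac{4m}{b}\left(\frac{n-b}{n-1}\right)}+1\right)}.$$ Then, for any given $\tilde w_0\in\mathbb{R}^d$, $$\frac{1}{(m+1)S}\sum_{s=1}^S\sum_{t=0}^m \mathbb{E}\big[\|\nabla F(w_t^{(s)})\|^2\big]\le \frac{2}{\eta\,[(m+1)S]}\,[F(\tilde w_0)-F^*],$$ where $F^*$ is any lower bound of $F$ and $w_t^{(s)}$ is the $t$-th iterate in the $s$-th outer loop.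
   Context: Setting: $f_1,\dots,f_n:\mathbb{R}^d\to\mathbb{R}$ are differentiable and $F=\frac1n\sum_{i=1}^n f_i$ has a finite lower bound. $L$-average-smooth: there is a constant $L>0$ with $\frac1n\sum_{i=1}^n\|\nabla f_i(w)-\nabla f_i(w')\|^2\le L^2\|w-w'\|^2$ for all $w,w'\in\mathbb{R}^d$. Mini-batch SARAH. Parameters: learning rate $\eta>0$, batch size $b$, inner loop size $m$ (an integer $\ge 0$), outer loop size $S$ (an integer $\ge 1$), starting point $\tilde w_0$. For $s=1,\dots,S$: set $w_0^{(s)}=\tilde w_{s-1}$, $v_0^{(s)}=\frac1n\sum_{i=1}^n\nabla f_i(w_0^{(s)})$, $w_1^{(s)}=w_0^{(s)}-\eta v_0^{(s)}$; then for $t=1,\dots,m$ choose a subset $I_t\subseteq\{1,\dots,n\}$ of size $b$ uniformly at random (independently of everything before) and set $v_t^{(s)}=\frac1b\sum_{i\in I_t}[\nabla f_i(w_t^{(s)})-\nabla f_i(w_{t-1}^{(s)})]+v_{t-1}^{(s)}$ and $w_{t+1}^{(s)}=w_t^{(s)}-\eta v_t^{(s)}$; finally set $\tilde w_s=w_{m+1}^{(s)}$. $\mathbb{E}$ denotes expectation over all the random choices. *)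

theory Defs
  imports "HOL-Probability.Probability"
begin

definition grad :: "('a::real_inner \<Rightarrow> real) \<Rightarrow> 'a \<Rightarrow> 'a" where
  "grad g w = (THE D. GDERIV g w :> D)"

lemma grad_eqI:
  assumes "GDERIV g w :> D"
  shows "grad g w = D"
  unfolding grad_def
proof (rule the_equality[where P = "\<lambda>D. GDERIV g w :> D"])
  fix E assume "GDERIV g w :> E"
  with assms have "(\<lambda>h. inner h D) = (\<lambda>h. inner h E)"
    unfolding gderiv_def by (rule has_derivative_unique)
  then have "inner (E - D) (E - D) = 0"
    by (metis (no_types) inner_diff_right right_minus_eq)
  then show "E = D" by simp
qed (fact assms)

lemma GDERIV_grad:
  fixes g :: "'a::euclidean_space \<Rightarrow> real"
  assumes "g differentiable (at w)"
  shows "GDERIV g w :> grad g w"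
proof -
  obtain g' where g': "(g has_derivative g') (at w)"
    using assms by (auto simp: differentiable_def)
  then interpret linear g' by (rule has_derivative_linear)
  have "g' = (\<lambda>h. inner h (\<Sum>i\<in>Basis. g' i *\<^sub>R i))"
  proof
    fix h
    have "g' h = g' (\<Sum>i\<in>Basis. inner h i *\<^sub>R i)"
      by (simp add: euclidean_representation)
    also have "\<dots> = inner h (\<Sum>i\<in>Basis. g' i *\<^sub>R i)"
      by (simp add: sum scale inner_sum_right mult.commute)
    finally show "g' h = inner h (\<Sum>i\<in>Basis. g' i *\<^sub>R i)" .
  qed
  with g' have "GDERIV g w :> (\<Sum>i\<in>Basis. g' i *\<^sub>R i)"
    unfolding gderiv_def by simp
  then show ?thesis by (simp add: grad_eqI)
qed

definition avg_fun :: "nat \<Rightarrow> (nat \<Rightarrow> 'a \<Rightarrow> real) \<Rightarrow> 'a \<Rightarrow> real" where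
  "avg_fun n f w = (1 / real n) * (\<Sum>i\<in>{1..n}. f i w)"

definition avg_smooth :: "real \<Rightarrow> nat \<Rightarrow> (nat \<Rightarrow> 'a::real_inner \<Rightarrow> real) \<Rightarrow> bool" where
  "avg_smooth L n f \<longleftrightarrow> L > 0 \<and>
     (\<forall>w w'. (1 / real n) * (\<Sum>i\<in>{1..n}. (norm (grad (f i) w - grad (f i) w'))\<^sup>2)
              \<le> L\<^sup>2 * (norm (w - w'))\<^sup>2)"

definition batches :: "nat \<Rightarrow> nat \<Rightarrow> nat set set" where
  "batches n b = {J. J \<subseteq> {1..n} \<and> card J = b}"

text \<open>One inner loop started at \<open>x\<close>, for a given sequence of mini-batches \<open>J\<close>
  (of which only the entries \<open>J t\<close> with \<open>t \<ge> 1\<close> are used).\<close>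

function sarah_w :: "nat \<Rightarrow> (nat \<Rightarrow> 'a::real_inner \<Rightarrow> real) \<Rightarrow> real \<Rightarrow> nat \<Rightarrow> (nat \<Rightarrow> nat set) \<Rightarrow> 'a \<Rightarrow> nat \<Rightarrow> 'a"
  and sarah_v :: "nat \<Rightarrow> (nat \<Rightarrow> 'a::real_inner \<Rightarrow> real) \<Rightarrow> real \<Rightarrow> nat \<Rightarrow> (nat \<Rightarrow> nat set) \<Rightarrow> 'a \<Rightarrow> nat \<Rightarrow> 'a"
where
  "sarah_w n f \<eta> b J x 0 = x"
| "sarah_w n f \<eta> b J x (Suc t) = sarah_w n f \<eta> b J x t - \<eta> *\<^sub>R sarah_v n f \<eta> b J x t"
| "sarah_v n f \<eta> b J x 0 = (1 / real n) *\<^sub>R (\<Sum>i\<in>{1..n}. grad (f i) (sarah_w n f \<eta> b J x 0))"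
| "sarah_v n f \<eta> b J x (Suc t) =
     (1 / real b) *\<^sub>R (\<Sum>i\<in>J (Suc t). grad (f i) (sarah_w n f \<eta> b J x (Suc t))
                                      - grad (f i) (sarah_w n f \<eta> b J x t))
     + sarah_v n f \<eta> b J x t"
  by pat_completeness auto
termination
  by (relation "Wellfounded.measure (\<lambda>p. case p of
        Inl (n, f, \<eta>, b, J, x, t) \<Rightarrow> 2 * t
      | Inr (n, f, \<eta>, b, J, x, t) \<Rightarrow> 2 * t + 1)") auto

text \<open>\<open>J s t\<close> is the mini-batch of inner step \<open>t\<close> in outer loop \<open>s\<close>, for \<open>s, t \<ge> 1\<close>;
  \<open>sarah_outer \<dots> s\<close> is the iterate returned by outer loop \<open>s\<close>, with \<open>x\<close> the starting point.\<close>

primrec sarah_outer :: "nat \<Rightarrow> (nat \<Rightarrow> 'a::real_inner \<Rightarrow> real) \<Rightarrow> real \<Rightarrow> nat \<Rightarrow> nat \<Rightarrow>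
    (nat \<Rightarrow> nat \<Rightarrow> nat set) \<Rightarrow> 'a \<Rightarrow> nat \<Rightarrow> 'a" where
  "sarah_outer n f \<eta> b m J x 0 = x"
| "sarah_outer n f \<eta> b m J x (Suc s) =
     sarah_w n f \<eta> b (J (Suc s)) (sarah_outer n f \<eta> b m J x s) (m + 1)"

text \<open>The iterate \<open>t\<close> of outer loop \<open>s \<ge> 1\<close>.\<close>

definition sarah_iter :: "nat \<Rightarrow> (nat \<Rightarrow> 'a::real_inner \<Rightarrow> real) \<Rightarrow> real \<Rightarrow> nat \<Rightarrow> nat \<Rightarrow>
    (nat \<Rightarrow> nat \<Rightarrow> nat set) \<Rightarrow> 'a \<Rightarrow> nat \<Rightarrow> nat \<Rightarrow> 'a" where
  "sarah_iter n f \<eta> b m J x s t = sarah_w n f \<eta> b (J s) (sarah_outer n f \<eta> b m J x (s - 1)) t"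

text \<open>The mini-batches \<open>I s t\<close>, \<open>1 \<le> s \<le> S\<close>, \<open>1 \<le> t \<le> m\<close>, are jointly independent and each
  is uniform on \<open>batches n b\<close>. As they are the only source of randomness, joint independence is
  the independence of each draw from everything before it.\<close>

definition uniform_batches ::
  "'z measure \<Rightarrow> nat \<Rightarrow> nat \<Rightarrow> nat \<Rightarrow> nat \<Rightarrow> (nat \<Rightarrow> nat \<Rightarrow> 'z \<Rightarrow> nat set) \<Rightarrow> bool" where
  "uniform_batches M n b m S I \<longleftrightarrow>
     prob_space.indep_vars M (\<lambda>_. count_space (batches n b)) (\<lambda>(s, t). I s t) ({1..S} \<times> {1..m}) \<and>
     (\<forall>s\<in>{1..S}. \<forall>t\<in>{1..m}.
        distr M (count_space (batches n b)) (I s t) = uniform_count_measure (batches n b))"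

end

theory Submission
  imports Defs
begin

text \<open>Write \<open>e\<^sub>t = v\<^sub>t - \<nabla>F(w\<^sub>t)\<close> within one inner loop. The descent lemma and the polarisation
  of \<open>\<langle>\<nabla>F(w\<^sub>t), v\<^sub>t\<rangle>\<close> bound \<open>F(w\<^sub>t\<^sub>+\<^sub>1)\<close> by
  \<open>F(w\<^sub>t) - (\<eta>/2) |\<nabla>F(w\<^sub>t)|\<^sup>2 + (\<eta>/2) |e\<^sub>t|\<^sup>2 - (\<eta>/2)(1 - L\<eta>) |v\<^sub>t|\<^sup>2\<close>. Given the past, the increment
  \<open>e\<^sub>t\<^sub>+\<^sub>1 - e\<^sub>t\<close> is the centred error of sampling \<open>b\<close> out of \<open>n\<close> without replacement, so
  \<open>E|e\<^sub>t\<^sub>+\<^sub>1|\<^sup>2 \<le> E|e\<^sub>t|\<^sup>2 + \<kappa> E|v\<^sub>t|\<^sup>2\<close> with \<open>\<kappa> = (n - b) / (b (n - 1)) L\<^sup>2 \<eta>\<^sup>2\<close>. The step size is chosen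
  exactly so that \<open>m \<kappa> \<le> 1 - L\<eta>\<close>; the accumulated errors are then absorbed by the terms in
  \<open>|v\<^sub>t|\<^sup>2\<close> and the values of \<open>F\<close> telescope over both loops.\<close>

subsection \<open>Smoothness of the average\<close>

lemma GDERIV_avg_fun:
  fixes f :: "nat \<Rightarrow> 'a::euclidean_space \<Rightarrow> real"
  assumes "\<And>i. i \<in> {1..n} \<Longrightarrow> f i differentiable (at w)"
  shows "GDERIV (avg_fun n f) w :> (1 / real n) *\<^sub>R (\<Sum>i\<in>{1..n}. grad (f i) w)"
proof -
  have "(f i has_derivative (\<lambda>h. inner h (grad (f i) w))) (at w)" if "i \<in> {1..n}" for i
    using GDERIV_grad[OF assms[OF that]] by (simp add: gderiv_def)
  then have "((\<lambda>w. (1 / real n) * (\<Sum>i\<in>{1..n}. f i w)) has_derivative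
      (\<lambda>h. (1 / real n) * (\<Sum>i\<in>{1..n}. inner h (grad (f i) w)))) (at w)"
    by (intro has_derivative_mult_right has_derivative_sum)
  then show ?thesis
    by (simp add: gderiv_def avg_fun_def[abs_def] inner_sum_right)
qed

text \<open>Expanding the squares around the mean leaves the second moment minus the squared mean.
  Nonnegativity of the left side bounds the squared norm of a mean by the mean squared norm, and
  dropping the subtracted term replaces a centred second moment by a raw one; both consequences are
  used below.\<close>

lemma sum_norm_diff_mean:
  fixes a :: "nat \<Rightarrow> 'a::real_inner"
  assumes "n \<ge> 1"
  shows "(\<Sum>i\<in>{1..n}. (norm (a i - (1 / real n) *\<^sub>R (\<Sum>i\<in>{1..n}. a i)))\<^sup>2)
    = (\<Sum>i\<in>{1..n}. (norm (a i))\<^sup>2) - real n * (norm ((1 / real n) *\<^sub>R (\<Sum>i\<in>{1..n}. a i)))\<^sup>2"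
proof -
  define s where "s = (1 / real n) *\<^sub>R (\<Sum>i\<in>{1..n}. a i)"
  have s: "(\<Sum>i\<in>{1..n}. a i) = real n *\<^sub>R s"
    using assms by (simp add: s_def)
  have "(\<Sum>i\<in>{1..n}. (norm (a i - s))\<^sup>2)
    = (\<Sum>i\<in>{1..n}. (norm (a i))\<^sup>2 - 2 * inner (a i) s + (norm s)\<^sup>2)"
    by (intro sum.cong refl) (simp add: power2_norm_eq_inner inner_diff inner_commute)
  also have "\<dots> = (\<Sum>i\<in>{1..n}. (norm (a i))\<^sup>2) - 2 * inner (\<Sum>i\<in>{1..n}. a i) s + real n * (norm s)\<^sup>2"
    by (simp add: sum.distrib sum_subtractf inner_sum_left sum_distrib_left)
  also have "\<dots> = (\<Sum>i\<in>{1..n}. (norm (a i))\<^sup>2) - real n * (norm s)\<^sup>2"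
    unfolding s by (simp add: power2_norm_eq_inner)
  finally show ?thesis by (simp add: s_def)
qed

lemma grad_avg_fun_lipschitz:
  fixes f :: "nat \<Rightarrow> 'a::euclidean_space \<Rightarrow> real"
  assumes "n \<ge> 1"
    and diff: "\<And>i w. i \<in> {1..n} \<Longrightarrow> f i differentiable (at w)"
    and "avg_smooth L n f"
  shows "norm (grad (avg_fun n f) x - grad (avg_fun n f) y) \<le> L * norm (x - y)"
proof -
  define a where "a i = grad (f i) x - grad (f i) y" for i
  have g: "grad (avg_fun n f) w = (1 / real n) *\<^sub>R (\<Sum>i\<in>{1..n}. grad (f i) w)" for w
    by (intro grad_eqI GDERIV_avg_fun diff)
  have d: "grad (avg_fun n f) x - grad (avg_fun n f) y = (1 / real n) *\<^sub>R (\<Sum>i\<in>{1..n}. a i)"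
    by (simp add: g a_def sum_subtractf scaleR_right_diff_distrib)
  \<comment> \<open>This is Jensen's inequality for the squared norm, which is what passes from
    smoothness on average to a Lipschitz gradient of the average.\<close>
  have "0 \<le> (\<Sum>i\<in>{1..n}. (norm (a i))\<^sup>2) - real n * (norm ((1 / real n) *\<^sub>R (\<Sum>i\<in>{1..n}. a i)))\<^sup>2"
    unfolding sum_norm_diff_mean[OF assms(1), symmetric] by (intro sum_nonneg) auto
  then have "(norm ((1 / real n) *\<^sub>R (\<Sum>i\<in>{1..n}. a i)))\<^sup>2 \<le> (1 / real n) * (\<Sum>i\<in>{1..n}. (norm (a i))\<^sup>2)"
    using assms(1) by (simp add: field_simps del: norm_scaleR)
  also have "\<dots> \<le> L\<^sup>2 * (norm (x - y))\<^sup>2"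
    using assms(3) unfolding avg_smooth_def a_def by blast
  finally show ?thesis
    using assms(3) unfolding d power_mult_distrib[symmetric] avg_smooth_def
    by (elim power2_le_imp_le) simp
qed

text \<open>The gap between \<open>g\<close> and its quadratic upper model, restricted to the
  segment from \<open>x\<close> to \<open>y\<close>, has nonpositive derivative by Cauchy-Schwarz
  and the Lipschitz bound. Monotonicity of this gap, the \<open>\<phi>\<close> below, replaces
  integration of the gradient along the segment.\<close>

lemma descent_lemma:
  fixes g :: "'a::real_inner \<Rightarrow> real"
  assumes deriv: "\<And>w. GDERIV g w :> D w"
    and lip: "\<And>x y. norm (D x - D y) \<le> L * norm (x - y)"
  shows "g y \<le> g x + inner (D x) (y - x) + L / 2 * (norm (y - x))\<^sup>2"
proof -
  define h where "h = y - x"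
  define \<phi> where "\<phi> t = g (x + t *\<^sub>R h) - t * inner (D x) h - L / 2 * t\<^sup>2 * (norm h)\<^sup>2" for t :: real
  have "\<phi> 1 \<le> \<phi> 0"
  proof (rule DERIV_nonpos_imp_nonincreasing[of 0 1 \<phi>])
    show "(0::real) \<le> 1" by simp
  next
    fix t :: real assume t: "0 \<le> t" "t \<le> 1"
    have "((\<lambda>t. g (x + t *\<^sub>R h)) has_derivative (\<lambda>s. inner (s *\<^sub>R h) (D (x + t *\<^sub>R h)))) (at t)"
      by (rule has_derivative_compose[where f = "\<lambda>t. x + t *\<^sub>R h" and f' = "\<lambda>s. s *\<^sub>R h" and g = g])
        (use deriv[of "x + t *\<^sub>R h"] in \<open>auto simp: gderiv_def intro!: derivative_eq_intros\<close>)
    then have "((\<lambda>t. g (x + t *\<^sub>R h)) has_real_derivative inner h (D (x + t *\<^sub>R h))) (at t)"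
      by (simp add: has_field_derivative_def mult.commute[of _ "inner h _"])
    then have "(\<phi> has_real_derivative
        inner h (D (x + t *\<^sub>R h)) - inner (D x) h - L * t * (norm h)\<^sup>2) (at t)"
      unfolding \<phi>_def by (auto intro!: derivative_eq_intros)
    moreover have "inner h (D (x + t *\<^sub>R h)) - inner (D x) h - L * t * (norm h)\<^sup>2 \<le> 0"
    proof -
      have "inner h (D (x + t *\<^sub>R h)) - inner (D x) h = inner h (D (x + t *\<^sub>R h) - D x)"
        by (simp add: inner_diff_right inner_commute)
      also have "\<dots> \<le> norm h * norm (D (x + t *\<^sub>R h) - D x)"
        by (rule norm_cauchy_schwarz)
      also have "\<dots> \<le> norm h * (L * norm (x + t *\<^sub>R h - x))"
        by (intro mult_left_mono lip) auto
      also have "\<dots> = L * t * (norm h)\<^sup>2"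
        using t by (simp add: power2_eq_square)
      finally show ?thesis by simp
    qed
    ultimately show "\<exists>y. (\<phi> has_real_derivative y) (at t) \<and> y \<le> 0" by blast
  qed
  then show ?thesis by (simp add: \<phi>_def h_def)
qed

subsection \<open>Sampling without replacement\<close>

text \<open>Removing \<open>i\<close> turns the sets counted on the left into the subsets of
  \<open>A - {i}\<close> with one element less, and the claim becomes the absorption identity for
  binomial coefficients. The product form avoids division and covers \<open>b = 0\<close> and
  \<open>b > card A\<close>.\<close>

lemma card_subsets_containing:
  assumes "finite A" "i \<in> A"
  shows "card A * card {J. J \<subseteq> A \<and> card J = b \<and> i \<in> J} = b * card {J. J \<subseteq> A \<and> card J = b}"
proof (cases b)
  case 0
  \<comment> \<open>Finiteness matters here, since infinite sets also have \<open>card\<close>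
    0.\<close>
  have "\<not> (J \<subseteq> A \<and> card J = 0 \<and> i \<in> J)" for J
    using assms(1) finite_subset[of J A] by auto
  then have "{J. J \<subseteq> A \<and> card J = b \<and> i \<in> J} = {}" unfolding 0 by blast
  then show ?thesis unfolding 0 by (simp only: card.empty mult_0_right mult_0)
next
  case (Suc c)
  have "bij_betw (insert i) {J. J \<subseteq> A - {i} \<and> card J = c} {J. J \<subseteq> A \<and> card J = b \<and> i \<in> J}"
  proof (rule bij_betwI[where g = "\<lambda>J. J - {i}"])
    show "insert i \<in> {J. J \<subseteq> A - {i} \<and> card J = c} \<rightarrow> {J. J \<subseteq> A \<and> card J = b \<and> i \<in> J}"
    proof
      fix J assume "J \<in> {J. J \<subseteq> A - {i} \<and> card J = c}"
      then have "J \<subseteq> A - {i}" "card J = c" by auto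
      then show "insert i J \<in> {J. J \<subseteq> A \<and> card J = b \<and> i \<in> J}"
        using assms Suc finite_subset[of J "A - {i}"] by (auto simp: card_insert_if)
    qed
  qed (auto simp: Suc card_Diff_singleton)
  then have "card {J. J \<subseteq> A \<and> card J = b \<and> i \<in> J} = (card A - 1) choose c"
    using assms by (simp add: bij_betw_same_card[symmetric] n_subsets)
  moreover obtain a where "card A = Suc a"
    using assms by (cases "card A") auto
  ultimately show ?thesis
    using Suc_times_binomial_eq[of a c] unfolding n_subsets[OF assms(1)] Suc
    by (simp only: diff_Suc_1 mult.commute)
qed

text \<open>The one-element count is applied twice: to \<open>i\<close> in \<open>A\<close>, and to
  \<open>j\<close> in \<open>A - {i}\<close> with size \<open>b - 1\<close>.\<close>

lemma card_subsets_containing2: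
  assumes "finite A" "i \<in> A" "j \<in> A" "i \<noteq> j" "b \<ge> 1"
  shows "card A * (card A - 1) * card {J. J \<subseteq> A \<and> card J = b \<and> i \<in> J \<and> j \<in> J}
    = b * (b - 1) * card {J. J \<subseteq> A \<and> card J = b}"
proof -
  \<comment> \<open>Any side condition \<open>P\<close> insensitive to \<open>i\<close> survives the
    removal of \<open>i\<close>. It is used with membership of \<open>j\<close> and with the trivial
    condition.\<close>
  have b: "bij_betw (insert i) {J. J \<subseteq> A - {i} \<and> card J = b - 1 \<and> P J}
      {J. J \<subseteq> A \<and> card J = b \<and> i \<in> J \<and> P J}"
    if P: "\<And>J. P (insert i J) = P J" "\<And>J. P (J - {i}) = P J" for P
  proof (rule bij_betwI[where g = "\<lambda>J. J - {i}"])
    show "insert i \<in> {J. J \<subseteq> A - {i} \<and> card J = b - 1 \<and> P J} \<rightarrow> {J. J \<subseteq> A \<and> card J = b \<and> i \<in> J \<and> P J}"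
    proof
      fix J assume "J \<in> {J. J \<subseteq> A - {i} \<and> card J = b - 1 \<and> P J}"
      then have "J \<subseteq> A - {i}" "card J = b - 1" "P J" by auto
      then show "insert i J \<in> {J. J \<subseteq> A \<and> card J = b \<and> i \<in> J \<and> P J}"
        using assms finite_subset[of J "A - {i}"] by (auto simp: card_insert_if P)
    qed
  qed (auto simp: card_Diff_singleton P)
  have "card A * ((card A - 1) * card {J. J \<subseteq> A \<and> card J = b \<and> i \<in> J \<and> j \<in> J})
    = card A * (card (A - {i}) * card {J. J \<subseteq> A - {i} \<and> card J = b - 1 \<and> j \<in> J})"
    using bij_betw_same_card[OF b[of "\<lambda>J. j \<in> J"]] assms by simp
  also have "\<dots> = card A * ((b - 1) * card {J. J \<subseteq> A - {i} \<and> card J = b - 1})"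
    using assms by (subst card_subsets_containing) auto
  also have "\<dots> = (b - 1) * (card A * card {J. J \<subseteq> A \<and> card J = b \<and> i \<in> J})"
    using bij_betw_same_card[OF b[of "\<lambda>_. True"]] assms by simp
  also have "\<dots> = (b - 1) * (b * card {J. J \<subseteq> A \<and> card J = b})"
    using assms by (subst card_subsets_containing) auto
  finally show ?thesis by (simp add: mult_ac)
qed

lemma finite_batches: "finite (batches n b)"
  unfolding batches_def by (rule finite_subset[of _ "Pow {1..n}"]) auto

lemma card_batches: "card (batches n b) = n choose b"
  unfolding batches_def by (simp add: n_subsets)

text \<open>After exchanging the sums, every index is counted equally often, namely in a fraction
  \<open>b / n\<close> of all batches. This is the unbiasedness of the batch average.\<close>

lemma sum_batches_sum:
  fixes u :: "nat \<Rightarrow> 'a::real_vector"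
  assumes "n \<ge> 1"
  shows "(\<Sum>J\<in>batches n b. \<Sum>i\<in>J. u i)
    = (real b * real (card (batches n b)) / real n) *\<^sub>R (\<Sum>i\<in>{1..n}. u i)"
proof -
  have "(\<Sum>J\<in>batches n b. \<Sum>i\<in>J. u i) = (\<Sum>J\<in>batches n b. \<Sum>i\<in>{i\<in>{1..n}. i \<in> J}. u i)"
    by (intro sum.cong) (auto simp: batches_def)
  also have "\<dots> = (\<Sum>i\<in>{1..n}. \<Sum>J\<in>{J\<in>batches n b. i \<in> J}. u i)"
    by (rule sum.swap_restrict) (auto simp: finite_batches)
  also have "\<dots> = (\<Sum>i\<in>{1..n}. (real b * real (card (batches n b)) / real n) *\<^sub>R u i)"
  proof (intro sum.cong refl)
    fix i assume i: "i \<in> {1..n}"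
    have "real n * real (card {J\<in>batches n b. i \<in> J}) = real b * real (card (batches n b))"
      using card_subsets_containing[of "{1..n}" i b] i
      by (simp add: batches_def conj_assoc flip: of_nat_mult)
    then have "real (card {J\<in>batches n b. i \<in> J}) = real b * real (card (batches n b)) / real n"
      using assms by (simp add: field_simps)
    then show "(\<Sum>J\<in>{J\<in>batches n b. i \<in> J}. u i) = (real b * real (card (batches n b)) / real n) *\<^sub>R u i"
      by (simp add: sum_constant_scaleR)
  qed
  finally show ?thesis by (simp add: scaleR_sum_right)
qed

text \<open>The square expands into inner products over pairs of indices, and the number of batches
  containing a pair depends only on whether its two entries coincide. For centred vectors only the
  diagonal surplus survives; it carries the factor \<open>n - b\<close> typical of sampling without
  replacement.\<close>

lemma sum_batches_norm_sum:
  fixes u :: "nat \<Rightarrow> 'a::real_inner"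
  assumes "n \<ge> 2" "b \<ge> 1" and u0: "(\<Sum>i\<in>{1..n}. u i) = 0"
  shows "(\<Sum>J\<in>batches n b. (norm (\<Sum>i\<in>J. u i))\<^sup>2)
    = real b * (real n - real b) * real (card (batches n b)) / (real n * (real n - 1))
      * (\<Sum>i\<in>{1..n}. (norm (u i))\<^sup>2)"
proof -
  define N where "N = real (card (batches n b))"
  \<comment> \<open>\<open>p\<close> will be the number of batches containing a given index,
    \<open>q\<close> the number containing two given distinct indices.\<close>
  define p where "p = real b * N / real n"
  define q where "q = real b * (real b - 1) * N / (real n * (real n - 1))"
  have c1: "real (card {J\<in>batches n b. i \<in> J}) = p" if i: "i \<in> {1..n}" for i
  proof -
    have "real n * real (card {J\<in>batches n b. i \<in> J}) = real b * N"
      using card_subsets_containing[of "{1..n}" i b] i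
      by (simp add: batches_def conj_assoc N_def flip: of_nat_mult)
    then show ?thesis using assms by (simp add: field_simps p_def)
  qed
  have c2: "real (card {J\<in>batches n b. i \<in> J \<and> j \<in> J}) = q" if i: "i \<in> {1..n}" "j \<in> {1..n}" "i \<noteq> j" for i j
  proof -
    have "n * (n - 1) * card {J\<in>batches n b. i \<in> J \<and> j \<in> J} = b * (b - 1) * card (batches n b)"
    proof -
      have "{J\<in>batches n b. i \<in> J \<and> j \<in> J} = {J. J \<subseteq> {1..n} \<and> card J = b \<and> i \<in> J \<and> j \<in> J}"
        by (auto simp: batches_def)
      then show ?thesis
        using card_subsets_containing2[OF finite_atLeastAtMost i assms(2)]
        by (simp only: batches_def card_atLeastAtMost diff_Suc_1)
    qed
    then have "real n * real (n - 1) * real (card {J\<in>batches n b. i \<in> J \<and> j \<in> J}) = real b * real (b - 1) * N"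
      unfolding N_def by (simp only: flip: of_nat_mult)
    moreover have "real (n - 1) = real n - 1" "real (b - 1) = real b - 1"
      using assms(1,2) by (auto simp: of_nat_diff)
    ultimately have "real n * (real n - 1) * real (card {J\<in>batches n b. i \<in> J \<and> j \<in> J}) = real b * (real b - 1) * N"
      by (simp only:)
    then have "real (card {J\<in>batches n b. i \<in> J \<and> j \<in> J}) * (real n * (real n - 1)) = real b * (real b - 1) * N"
      by (simp only: mult.commute)
    moreover have "real n * (real n - 1) \<noteq> 0" using assms by simp
    ultimately show ?thesis unfolding q_def by (rule eq_divide_imp[rotated])
  qed
  have "(\<Sum>J\<in>batches n b. (norm (\<Sum>i\<in>J. u i))\<^sup>2)
      = (\<Sum>J\<in>batches n b. \<Sum>x\<in>J \<times> J. inner (u (fst x)) (u (snd x)))"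
    by (simp only: power2_norm_eq_inner inner_sum_left)
      (simp only: inner_sum_right sum.cartesian_product case_prod_unfold)
  also have "\<dots> = (\<Sum>J\<in>batches n b. \<Sum>x\<in>{x\<in>{1..n} \<times> {1..n}. fst x \<in> J \<and> snd x \<in> J}. inner (u (fst x)) (u (snd x)))"
    by (intro sum.cong) (auto simp: batches_def)
  also have "\<dots> = (\<Sum>x\<in>{1..n} \<times> {1..n}. \<Sum>J\<in>{J\<in>batches n b. fst x \<in> J \<and> snd x \<in> J}. inner (u (fst x)) (u (snd x)))"
    by (rule sum.swap_restrict) (auto simp: finite_batches)
  \<comment> \<open>All pairs receive the weight \<open>q\<close>, and the diagonal is corrected by
    \<open>p - q\<close>. The uniform part then factors into the squared norm of the total, which is
    zero.\<close>
  also have "\<dots> = (\<Sum>x\<in>{1..n} \<times> {1..n}. q * inner (u (fst x)) (u (snd x))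
      + (if snd x = fst x then (p - q) * (norm (u (fst x)))\<^sup>2 else 0))"
    by (intro sum.cong refl) (auto simp: c1 c2 power2_norm_eq_inner algebra_simps)
  also have "\<dots> = q * inner (\<Sum>i\<in>{1..n}. u i) (\<Sum>i\<in>{1..n}. u i) + (p - q) * (\<Sum>i\<in>{1..n}. (norm (u i))\<^sup>2)"
  proof -
    have "(\<Sum>x\<in>{1..n} \<times> {1..n}. q * inner (u (fst x)) (u (snd x))) = q * inner (\<Sum>i\<in>{1..n}. u i) (\<Sum>i\<in>{1..n}. u i)"
      by (simp only: inner_sum_left)
        (simp only: inner_sum_right sum.cartesian_product case_prod_unfold sum_distrib_left)
    moreover have "(\<Sum>x\<in>{1..n} \<times> {1..n}. if snd x = fst x then (p - q) * (norm (u (fst x)))\<^sup>2 else 0)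
        = (p - q) * (\<Sum>i\<in>{1..n}. (norm (u i))\<^sup>2)"
      by (simp add: sum.cartesian_product' sum_distrib_left)
    ultimately show ?thesis by (simp only: sum.distrib)
  qed
  also have "\<dots> = (p - q) * (\<Sum>i\<in>{1..n}. (norm (u i))\<^sup>2)"
    by (simp only: u0 inner_zero_left mult_zero_right add_0_left)
  also have "p - q = real b * (real n - real b) * N / (real n * (real n - 1))"
  proof -
    have "real n \<noteq> 0" "real n - 1 \<noteq> 0" using assms(1) by auto
    then show ?thesis
      unfolding p_def q_def by (simp add: divide_simps) (simp add: algebra_simps)
  qed
  finally show ?thesis by (simp only: N_def)
qed

text \<open>The left side is the mean over a uniform batch, with \<open>p\<close> an error already
  present. The fresh sampling error is centred, so its cross term with \<open>p\<close> averages to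
  zero and only its variance is added.\<close>

lemma batch_estimator_mse:
  fixes a :: "nat \<Rightarrow> 'a::real_inner"
  assumes n: "n \<ge> 2" and b: "1 \<le> b" "b \<le> n"
  shows "(\<Sum>J\<in>batches n b. (norm (p + (1 / real b) *\<^sub>R (\<Sum>i\<in>J. a i)
            - (1 / real n) *\<^sub>R (\<Sum>i\<in>{1..n}. a i)))\<^sup>2) / real (card (batches n b))
    \<le> (norm p)\<^sup>2 + 1 / real b * ((real n - real b) / (real n - 1)) * (1 / real n * (\<Sum>i\<in>{1..n}. (norm (a i))\<^sup>2))"
proof -
  define \<mu> where "\<mu> = (1 / real n) *\<^sub>R (\<Sum>i\<in>{1..n}. a i)"
  define u where "u i = a i - \<mu>" for i
  define N where "N = real (card (batches n b))"
  have N: "N > 0" using b by (simp add: N_def card_batches)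
  have u0: "(\<Sum>i\<in>{1..n}. u i) = 0"
    using n by (simp add: u_def sum_subtractf \<mu>_def sum_constant_scaleR)
  have "(\<Sum>J\<in>batches n b. (norm (p + (1 / real b) *\<^sub>R (\<Sum>i\<in>J. a i) - \<mu>))\<^sup>2)
    = (\<Sum>J\<in>batches n b. (norm p)\<^sup>2 + 2 / real b * inner p (\<Sum>i\<in>J. u i) + (1 / real b)\<^sup>2 * (norm (\<Sum>i\<in>J. u i))\<^sup>2)"
  proof (intro sum.cong refl)
    fix J assume J: "J \<in> batches n b"
    \<comment> \<open>Every batch has exactly \<open>b\<close> elements, so the mean can be
      subtracted term by term.\<close>
    then have "(1 / real b) *\<^sub>R (\<Sum>i\<in>J. a i) - \<mu> = (1 / real b) *\<^sub>R (\<Sum>i\<in>J. u i)"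
      using b by (simp add: u_def sum_subtractf sum_constant_scaleR batches_def scaleR_right_diff_distrib)
    then have *: "p + (1 / real b) *\<^sub>R (\<Sum>i\<in>J. a i) - \<mu> = p + (1 / real b) *\<^sub>R (\<Sum>i\<in>J. u i)"
      by (metis add_diff_eq)
    show "(norm (p + (1 / real b) *\<^sub>R (\<Sum>i\<in>J. a i) - \<mu>))\<^sup>2
      = (norm p)\<^sup>2 + 2 / real b * inner p (\<Sum>i\<in>J. u i) + (1 / real b)\<^sup>2 * (norm (\<Sum>i\<in>J. u i))\<^sup>2"
      unfolding * power2_norm_eq_inner
      by (simp add: inner_add inner_commute power2_eq_square)
  qed
  also have "\<dots> = N * (norm p)\<^sup>2 + 2 / real b * inner p (\<Sum>J\<in>batches n b. \<Sum>i\<in>J. u i)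
      + (1 / real b)\<^sup>2 * (\<Sum>J\<in>batches n b. (norm (\<Sum>i\<in>J. u i))\<^sup>2)"
    by (simp add: sum.distrib N_def sum_distrib_left inner_sum_right)
  also have "\<dots> = N * (norm p)\<^sup>2 + (1 / real b)\<^sup>2
      * (real b * (real n - real b) * N / (real n * (real n - 1)) * (\<Sum>i\<in>{1..n}. (norm (u i))\<^sup>2))"
    using n by (subst sum_batches_sum) (simp_all only: sum_batches_norm_sum[OF n b(1) u0] u0 N_def
        scaleR_zero_right inner_zero_right mult_zero_right add_0_right)
  also have "\<dots> = N * ((norm p)\<^sup>2
      + 1 / real b * ((real n - real b) / (real n - 1)) * (1 / real n * (\<Sum>i\<in>{1..n}. (norm (u i))\<^sup>2)))"
  proof -
    have "(1 / x)\<^sup>2 * (x * y * N / (z * z') * U) = N * (1 / x * (y / z') * (1 / z * U))" if "x \<noteq> 0" for x y z z' U :: real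
      using that by (simp add: power2_eq_square divide_simps)
    note this[of "real b" "real n - real b" "real n" "real n - 1"]
    moreover have "real b \<noteq> 0" using b by simp
    ultimately show ?thesis by (simp only: distrib_left not_False_eq_True)
  qed
  finally have "(\<Sum>J\<in>batches n b. (norm (p + (1 / real b) *\<^sub>R (\<Sum>i\<in>J. a i) - \<mu>))\<^sup>2) / N
    = (norm p)\<^sup>2 + 1 / real b * ((real n - real b) / (real n - 1)) * (1 / real n * (\<Sum>i\<in>{1..n}. (norm (u i))\<^sup>2))"
    using N by (simp only: nonzero_mult_div_cancel_left less_imp_neq[symmetric] not_False_eq_True)
  \<comment> \<open>Centring only decreases the sum of squares, and the raw sum is the one that
    average smoothness controls.\<close>
  also have "\<dots> \<le> (norm p)\<^sup>2 + 1 / real b * ((real n - real b) / (real n - 1)) * (1 / real n * (\<Sum>i\<in>{1..n}. (norm (a i))\<^sup>2))"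
  proof (intro add_left_mono mult_left_mono)
    show "(\<Sum>i\<in>{1..n}. (norm (u i))\<^sup>2) \<le> (\<Sum>i\<in>{1..n}. (norm (a i))\<^sup>2)"
      unfolding u_def \<mu>_def using n by (subst sum_norm_diff_mean) auto
  qed (use n b in auto)
  finally show ?thesis
    unfolding \<mu>_def N_def .
qed

subsection \<open>Averaging over an independent draw\<close>

text \<open>A combinatorial counterpart of measurability with respect to the coordinates in
  \<open>A\<close>. For draws from a finite set it suffices for integrability, and conditional
  expectations become finite averages.\<close>

definition determined_by :: "'i set \<Rightarrow> (('i \<Rightarrow> 'b) \<Rightarrow> 'c) \<Rightarrow> bool" where
  "determined_by A h \<longleftrightarrow> (\<forall>J J'. (\<forall>i\<in>A. J i = J' i) \<longrightarrow> h J = h J')"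

lemma determined_byI:
  assumes "\<And>J J'. (\<And>i. i \<in> A \<Longrightarrow> J i = J' i) \<Longrightarrow> h J = h J'"
  shows "determined_by A h"
  unfolding determined_by_def
proof (intro allI impI)
  fix J J' :: "'a \<Rightarrow> 'b" assume "\<forall>i\<in>A. J i = J' i"
  then show "h J = h J'" by (intro assms) simp
qed

lemma determined_byD:
  assumes "determined_by A h" "\<And>i. i \<in> A \<Longrightarrow> J i = J' i"
  shows "h J = h J'"
proof -
  have "\<forall>i\<in>A. J i = J' i" using assms(2) by blast
  then show ?thesis
    by (rule assms(1)[unfolded determined_by_def, THEN spec[of _ J], THEN spec[of _ J'], THEN mp])
qed

lemma determined_by_comp2:
  assumes "determined_by A h" "determined_by A h'"
  shows "determined_by A (\<lambda>J. \<phi> (h J) (h' J))"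
proof (rule determined_byI)
  fix J J' :: "'a \<Rightarrow> 'b" assume eq: "\<And>i. i \<in> A \<Longrightarrow> J i = J' i"
  have "h J = h J'" "h' J = h' J'"
    using assms[THEN determined_byD, of J J'] eq by blast+
  then show "\<phi> (h J) (h' J) = \<phi> (h J') (h' J')" by simp
qed

lemma determined_by_comp:
  assumes "determined_by A h"
  shows "determined_by A (\<lambda>J. \<phi> (h J))"
  by (rule determined_by_comp2[OF assms assms, of "\<lambda>x _. \<phi> x"])

lemma determined_by_mono:
  assumes "determined_by A h" "A \<subseteq> A'"
  shows "determined_by A' h"
proof (rule determined_byI)
  fix J J' :: "'a \<Rightarrow> 'b" assume "\<And>i. i \<in> A' \<Longrightarrow> J i = J' i"
  then show "h J = h J'"
    using determined_byD[OF assms(1), of J J'] assms(2) by blast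
qed

text \<open>Values off \<open>A\<close> are invisible to \<open>h\<close>, so \<open>h\<close> may
  be evaluated on restrictions, which range over a finite function space when \<open>A\<close> and
  the range of the draws are finite.\<close>

lemma determined_by_restrict:
  assumes "determined_by A h"
  shows "h (restrict J A) = h J"
  using determined_byD[OF assms, of "restrict J A" J] by simp

context prob_space
begin

lemma measurable_restrict_finite:
  assumes "finite A" "finite B" "\<And>i. i \<in> A \<Longrightarrow> random_variable (count_space B) (X i)"
  shows "(\<lambda>\<omega>. restrict (\<lambda>i. X i \<omega>) A) \<in> measurable M (count_space (A \<rightarrow>\<^sub>E B))"
proof -
  have "(\<lambda>\<omega>. restrict (\<lambda>i. X i \<omega>) A) \<in> measurable M (PiM A (\<lambda>_. count_space B))"
    by (intro measurable_restrict assms)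
  then show ?thesis
    using assms by (simp add: count_space_PiM_finite countable_finite)
qed

lemma integrable_determined_by:
  fixes h :: "('i \<Rightarrow> 'b) \<Rightarrow> real"
  assumes h: "determined_by A h" and "finite A" "finite B"
    and X: "\<And>i. i \<in> A \<Longrightarrow> random_variable (count_space B) (X i)"
  shows "integrable M (\<lambda>\<omega>. h (\<lambda>i. X i \<omega>))"
proof -
  let ?R = "\<lambda>\<omega>. restrict (\<lambda>i. X i \<omega>) A"
  have fin: "finite (A \<rightarrow>\<^sub>E B)" using assms by (intro finite_PiE) auto
  have R: "?R \<in> measurable M (count_space (A \<rightarrow>\<^sub>E B))"
    using assms by (intro measurable_restrict_finite) auto
  have "integrable M (\<lambda>\<omega>. h (?R \<omega>))"
  \<comment> \<open>Only finitely many restrictions can occur, so the sum of all absolute values is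
    a uniform bound.\<close>
  proof (rule integrable_const_bound[where B = "\<Sum>J\<in>A \<rightarrow>\<^sub>E B. \<bar>h J\<bar>"])
    show "(\<lambda>\<omega>. h (?R \<omega>)) \<in> borel_measurable M"
      by (rule measurable_compose[OF R]) simp
    have "\<bar>h (?R \<omega>)\<bar> \<le> (\<Sum>J\<in>A \<rightarrow>\<^sub>E B. \<bar>h J\<bar>)" if "\<omega> \<in> space M" for \<omega>
      using measurable_space[OF R that] fin
      by (intro member_le_sum[where f = "\<lambda>J. \<bar>h J\<bar>"]) auto
    then show "AE \<omega> in M. norm (h (?R \<omega>)) \<le> (\<Sum>J\<in>A \<rightarrow>\<^sub>E B. \<bar>h J\<bar>)" by simp
  qed
  then show ?thesis by (simp add: determined_by_restrict[OF h])
qed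

text \<open>This takes the place of conditioning on the past: with the coordinates in
  \<open>A\<close> frozen, the independent uniform draw \<open>X k\<close> may be averaged out. The
  integrand is split according to the value of \<open>X k\<close>, and each piece factors by
  independence.\<close>

lemma expectation_average_indep:
  fixes g :: "('i \<Rightarrow> 'b) \<Rightarrow> 'b \<Rightarrow> real"
  assumes indep: "indep_vars (\<lambda>_. count_space B) X K"
    and A: "A \<subseteq> K" "finite A" and k: "k \<in> K" "k \<notin> A" and B: "finite B"
    and unif: "distr M (count_space B) (X k) = uniform_count_measure B"
    and g: "\<And>C. determined_by A (\<lambda>J. g J C)"
  shows "expectation (\<lambda>\<omega>. g (\<lambda>i. X i \<omega>) (X k \<omega>))
    = expectation (\<lambda>\<omega>. (\<Sum>C\<in>B. g (\<lambda>i. X i \<omega>) C) / real (card B))"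
proof -
  have X: "random_variable (count_space B) (X i)" if "i \<in> K" for i
    using indep that by (auto simp: indep_vars_def)
  have int_g: "integrable M (\<lambda>\<omega>. g (\<lambda>i. X i \<omega>) C)" for C
    using A B X by (intro integrable_determined_by[OF g]) auto
  have ind: "determined_by {k} (\<lambda>J. if J k = C then 1 else 0 :: real)" for C
    by (auto simp: determined_by_def)
  have int_ind: "integrable M (\<lambda>\<omega>. if X k \<omega> = C then 1 else 0 :: real)" for C
    using B k X by (intro integrable_determined_by[OF ind[of C], of B X]) auto
  have prob_C: "expectation (\<lambda>\<omega>. if X k \<omega> = C then 1 else 0 :: real) = 1 / real (card B)" if "C \<in> B" for C
  proof -
    have "expectation (\<lambda>\<omega>. if X k \<omega> = C then 1 else 0 :: real)
        = integral\<^sup>L (distr M (count_space B) (X k)) (\<lambda>C'. if C' = C then 1 else 0)"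
      using X[OF k(1)] by (subst integral_distr) auto
    also have "\<dots> = 1 / real (card B)"
      unfolding unif using that B
      by (simp add: uniform_count_measure_def lebesgue_integral_point_measure_finite flip: sum_divide_distrib)
    finally show ?thesis .
  qed
  have indep_C: "expectation (\<lambda>\<omega>. g (\<lambda>i. X i \<omega>) C * (if X k \<omega> = C then 1 else 0))
      = expectation (\<lambda>\<omega>. g (\<lambda>i. X i \<omega>) C) * expectation (\<lambda>\<omega>. if X k \<omega> = C then 1 else 0)" for C
  proof -
    \<comment> \<open>Subfamilies indexed by the disjoint sets \<open>A\<close> and
      \<open>{k}\<close> are independent, and so are functions of them.\<close>
    have "indep_var (PiM A (\<lambda>_. count_space B)) (\<lambda>\<omega>. restrict (\<lambda>i. X i \<omega>) A)
        (PiM {k} (\<lambda>_. count_space B)) (\<lambda>\<omega>. restrict (\<lambda>i. X i \<omega>) {k})"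
      using A k by (intro indep_var_restrict[OF indep]) auto
    then have "indep_var borel ((\<lambda>J. g J C) \<circ> (\<lambda>\<omega>. restrict (\<lambda>i. X i \<omega>) A))
        borel ((\<lambda>J. if J k = C then 1 else 0 :: real) \<circ> (\<lambda>\<omega>. restrict (\<lambda>i. X i \<omega>) {k}))"
      by (rule indep_var_compose) (use A B in \<open>simp_all add: count_space_PiM_finite countable_finite\<close>)
    then have "indep_var borel (\<lambda>\<omega>. g (\<lambda>i. X i \<omega>) C) borel (\<lambda>\<omega>. if X k \<omega> = C then 1 else 0 :: real)"
      by (simp add: o_def determined_by_restrict[OF g])
    then show ?thesis
      by (intro indep_var_lebesgue_integral int_g int_ind)
  qed
  have "expectation (\<lambda>\<omega>. g (\<lambda>i. X i \<omega>) (X k \<omega>))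
      = expectation (\<lambda>\<omega>. \<Sum>C\<in>B. g (\<lambda>i. X i \<omega>) C * (if X k \<omega> = C then 1 else 0))"
  proof (intro Bochner_Integration.integral_cong refl)
    fix \<omega> assume "\<omega> \<in> space M"
    then have "X k \<omega> \<in> B" using measurable_space[OF X[OF k(1)]] by simp
    then show "g (\<lambda>i. X i \<omega>) (X k \<omega>) = (\<Sum>C\<in>B. g (\<lambda>i. X i \<omega>) C * (if X k \<omega> = C then 1 else 0))"
      using B by (simp add: if_distrib[of "\<lambda>x. _ * x"] cong: if_cong)
  qed
  also have "\<dots> = (\<Sum>C\<in>B. expectation (\<lambda>\<omega>. g (\<lambda>i. X i \<omega>) C * (if X k \<omega> = C then 1 else 0)))"
  proof (rule Bochner_Integration.integral_sum)
    fix C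
    have "determined_by (insert k A) (\<lambda>J. g J C * (if J k = C then 1 else 0))"
      by (rule determined_by_comp2[of _ "\<lambda>J. g J C" "\<lambda>J. if J k = C then 1 else 0 :: real" "(*)"])
        (auto intro: determined_by_mono[OF g] determined_by_mono[OF ind])
    from integrable_determined_by[OF this, of B X]
    show "integrable M (\<lambda>\<omega>. g (\<lambda>i. X i \<omega>) C * (if X k \<omega> = C then 1 else 0))"
      using A B k X by auto
  qed
  also have "\<dots> = (\<Sum>C\<in>B. expectation (\<lambda>\<omega>. g (\<lambda>i. X i \<omega>) C) * (1 / real (card B)))"
    by (intro sum.cong refl) (simp only: indep_C prob_C)
  also have "\<dots> = expectation (\<lambda>\<omega>. (\<Sum>C\<in>B. g (\<lambda>i. X i \<omega>) C) / real (card B))"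
    by (simp add: int_g sum_divide_distrib)
  finally show ?thesis .
qed

end

subsection \<open>Mini-batch SARAH\<close>

text \<open>Batch \<open>t\<close> first enters through direction \<open>t\<close>, so iterate
  \<open>t + 1\<close> depends on the same batches as direction \<open>t\<close>. The claims are
  proved jointly because the recursion is mutual.\<close>

lemma sarah_cong:
  assumes "\<And>r. r \<in> {1..t} \<Longrightarrow> J r = J' r"
  shows "sarah_w n f \<eta> b J x t = sarah_w n f \<eta> b J' x t
    \<and> sarah_w n f \<eta> b J x (Suc t) = sarah_w n f \<eta> b J' x (Suc t)
    \<and> sarah_v n f \<eta> b J x t = sarah_v n f \<eta> b J' x t"
  using assms
proof (induction t)
  case (Suc t)
  from Suc.prems have "J (Suc t) = J' (Suc t)" by simp
  moreover have "\<And>r. r \<in> {1..t} \<Longrightarrow> J r = J' r" using Suc.prems by simp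
  ultimately show ?case using Suc.IH by simp
qed simp

lemma sarah_outer_cong:
  assumes "\<And>s' r. s' \<in> {1..s} \<Longrightarrow> r \<in> {1..m} \<Longrightarrow> J s' r = J' s' r"
  shows "sarah_outer n f \<eta> b m J x s = sarah_outer n f \<eta> b m J' x s"
  using assms
proof (induction s)
  case (Suc s)
  have "sarah_outer n f \<eta> b m J x s = sarah_outer n f \<eta> b m J' x s"
    using Suc.prems by (intro Suc.IH) simp
  \<comment> \<open>The loop returns iterate \<open>m + 1\<close>, which is already fixed by the
    batches \<open>1\<close> to \<open>m\<close>.\<close>
  moreover have "sarah_w n f \<eta> b (J (Suc s)) y (Suc m) = sarah_w n f \<eta> b (J' (Suc s)) y (Suc m)" for y
    using Suc.prems by (intro sarah_cong[THEN conjunct2, THEN conjunct1]) simp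
  ultimately show ?case by simp
qed simp

section \<open>Deterministic estimates: the step size condition and the absorption of errors\<close>

text \<open>To be used with \<open>x = L * \<eta>\<close>. Keeping the square root in the
  denominator makes the bound meaningful also at \<open>c = 0\<close>, where the quadratic
  degenerates to a linear condition.\<close>

lemma step_size_bound:
  fixes x c :: real
  assumes "0 \<le> x" "0 \<le> c" and x: "x \<le> 2 / (sqrt (1 + 4 * c) + 1)"
  shows "c * x\<^sup>2 \<le> 1 - x"
proof -
  define r where "r = sqrt (1 + 4 * c)"
  have r: "r \<ge> 1" "r\<^sup>2 = 1 + 4 * c" using assms(2) by (simp_all add: r_def)
  have "x * (r + 1) \<le> 2" using x r(1) unfolding r_def[symmetric] by (simp add: pos_le_divide_eq)
  \<comment> \<open>\<open>2 / (r + 1)\<close> is the larger root of \<open>c x\<^sup>2 + x - 1\<close>; the other one is \<open>- 2 / (r - 1)\<close>.\<close>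
  then have "0 \<le> (2 - x * (r + 1)) * (2 + x * (r - 1))"
    using assms(1) r(1) by (intro mult_nonneg_nonneg) auto
  also have "\<dots> = 4 - 4 * x - x\<^sup>2 * (r\<^sup>2 - 1)"
    by (simp add: power2_eq_square algebra_simps)
  also have "\<dots> = 4 * (1 - x - c * x\<^sup>2)"
    by (simp add: r(2) algebra_simps)
  finally show ?thesis by simp
qed

text \<open>The sequences stand for the expectations of the squared gradient, the squared error, the
  squared direction and the objective. Each error is at most \<open>\<kappa>\<close> times the total
  of the \<open>V t\<close>, so all errors together are paid for by the negative terms with
  \<open>\<delta>\<close>, and \<open>\<Phi>\<close> telescopes.\<close>

lemma sum_gradients_le:
  fixes A E V \<Phi> :: "nat \<Rightarrow> real"
  assumes "0 < \<eta>" "0 \<le> \<kappa>" and \<kappa>: "real m * \<kappa> \<le> \<delta>" and V: "\<And>t. V t \<ge> 0"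
    and descent: "\<And>t. t \<le> m \<Longrightarrow> \<Phi> (Suc t) \<le> \<Phi> t - \<eta> / 2 * A t + \<eta> / 2 * E t - \<eta> / 2 * \<delta> * V t"
    and E0: "E 0 = 0" and ES: "\<And>t. t < m \<Longrightarrow> E (Suc t) \<le> E t + \<kappa> * V t"
  shows "(\<Sum>t = 0..m. A t) \<le> 2 / \<eta> * (\<Phi> 0 - \<Phi> (Suc m))"
proof -
  define T where "T = (\<Sum>t\<le>m. V t)"
  have "E t \<le> \<kappa> * (\<Sum>j<t. V j)" if "t \<le> m" for t
    using that
  proof (induction t)
    case (Suc t)
    then show ?case using ES[of t] by (simp add: distrib_left)
  qed (simp add: E0)
  moreover have "(\<Sum>j<t. V j) \<le> T" if "t \<le> m" for t
    unfolding T_def using that V by (intro sum_mono2) auto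
  ultimately have "E t \<le> \<kappa> * T" if "t \<le> m" for t
    using that assms(2) by (meson mult_left_mono order_trans)
  then have "(\<Sum>t\<in>{1..m}. E t) \<le> (\<Sum>t\<in>{1..m}. \<kappa> * T)" by (intro sum_mono) auto
  then have "(\<Sum>t\<in>{1..m}. E t) \<le> real m * \<kappa> * T" by simp
  \<comment> \<open>The error at step 0 vanishes, so only \<open>m\<close> of the
    \<open>m + 1\<close> steps contribute; this matches the hypothesis on
    \<open>real m * \<kappa>\<close>.\<close>
  moreover have "(\<Sum>t\<le>m. E t) = (\<Sum>t\<in>{1..m}. E t)"
    using E0 by (simp add: atMost_atLeast0 sum.atLeast_Suc_atMost)
  moreover have "real m * \<kappa> * T \<le> \<delta> * T"
    using \<kappa> V unfolding T_def by (intro mult_right_mono sum_nonneg) auto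
  ultimately have E: "(\<Sum>t\<le>m. E t) \<le> \<delta> * T" by linarith
  have "(\<Sum>t\<le>m. \<Phi> (Suc t) - \<Phi> t) \<le> (\<Sum>t\<le>m. \<eta> / 2 * (E t - \<delta> * V t - A t))"
  proof (rule sum_mono)
    fix t assume "t \<in> {..m}"
    then have "\<Phi> (Suc t) \<le> \<Phi> t - \<eta> / 2 * A t + \<eta> / 2 * E t - \<eta> / 2 * \<delta> * V t"
      by (intro descent) simp
    moreover have "\<eta> / 2 * (E t - \<delta> * V t - A t) = \<eta> / 2 * E t - \<eta> / 2 * \<delta> * V t - \<eta> / 2 * A t"
      by (simp add: right_diff_distrib)
    ultimately show "\<Phi> (Suc t) - \<Phi> t \<le> \<eta> / 2 * (E t - \<delta> * V t - A t)" by linarith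
  qed
  also have "\<dots> = \<eta> / 2 * ((\<Sum>t\<le>m. E t) - \<delta> * T - (\<Sum>t\<le>m. A t))"
    by (simp only: T_def sum_distrib_left sum_subtractf right_diff_distrib)
  also have "(\<Sum>t\<le>m. \<Phi> (Suc t) - \<Phi> t) = \<Phi> (Suc m) - \<Phi> 0"
    by (simp add: lessThan_Suc_atMost[symmetric] sum_lessThan_telescope)
  also have "\<eta> / 2 * ((\<Sum>t\<le>m. E t) - \<delta> * T - (\<Sum>t\<le>m. A t)) \<le> \<eta> / 2 * (- (\<Sum>t\<le>m. A t))"
    using E assms(1) by (intro mult_left_mono) auto
  finally show ?thesis
    using assms(1) by (simp add: field_simps atMost_atLeast0)
qed

section \<open>A run as a function of its draws\<close>

locale sarah_run = prob_space M for M :: "'z measure" +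
  fixes f :: "nat \<Rightarrow> 'a::euclidean_space \<Rightarrow> real"
    and L \<eta> :: real and n b m S :: nat and w0 :: 'a and I :: "nat \<Rightarrow> nat \<Rightarrow> 'z \<Rightarrow> nat set"
  assumes n: "n \<ge> 2"
    and diff: "\<And>i w. i \<in> {1..n} \<Longrightarrow> f i differentiable (at w)"
    and smooth: "avg_smooth L n f"
    and b: "1 \<le> b" "b \<le> n"
    and \<eta>: "0 < \<eta>"
    and unif: "uniform_batches M n b m S I"
begin

abbreviation F :: "'a \<Rightarrow> real" where "F \<equiv> avg_fun n f"

text \<open>The batches are indexed by pairs, in the very form in which
  \<open>uniform_batches\<close> states independence, so that unfolding exposes the family expected
  by \<open>expectation_average_indep\<close>.\<close>

definition draws :: "'z \<Rightarrow> nat \<times> nat \<Rightarrow> nat set" where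
  "draws \<omega> = (\<lambda>i. (\<lambda>(s, t). I s t) i \<omega>)"

definition start :: "nat \<Rightarrow> (nat \<times> nat \<Rightarrow> nat set) \<Rightarrow> 'a" where
  "start s J = sarah_outer n f \<eta> b m (curry J) w0 s"

definition iter :: "nat \<Rightarrow> nat \<Rightarrow> (nat \<times> nat \<Rightarrow> nat set) \<Rightarrow> 'a" where
  "iter s t J = sarah_iter n f \<eta> b m (curry J) w0 s t"

definition dir :: "nat \<Rightarrow> nat \<Rightarrow> (nat \<times> nat \<Rightarrow> nat set) \<Rightarrow> 'a" where
  "dir s t J = sarah_v n f \<eta> b (curry J s) (start (s - 1) J) t"

definition err :: "nat \<Rightarrow> nat \<Rightarrow> (nat \<times> nat \<Rightarrow> nat set) \<Rightarrow> 'a" where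
  "err s t J = dir s t J - grad F (iter s t J)"

text \<open>The draws made up to step \<open>t\<close> of outer loop \<open>s\<close>; they also fix \<open>iter s (Suc t)\<close>.\<close>

definition past :: "nat \<Rightarrow> nat \<Rightarrow> (nat \<times> nat) set" where
  "past s t = {1..<s} \<times> {1..m} \<union> {s} \<times> {1..t}"

lemma finite_past: "finite (past s t)"
  by (simp add: past_def)

lemma past_subset: "s \<in> {1..S} \<Longrightarrow> t \<le> m \<Longrightarrow> past s t \<subseteq> {1..S} \<times> {1..m}"
  by (auto simp: past_def)

lemma grad_F: "grad F w = (1 / real n) *\<^sub>R (\<Sum>i\<in>{1..n}. grad (f i) w)"
  by (intro grad_eqI GDERIV_avg_fun diff)

lemma iter_0: "iter s 0 J = start (s - 1) J"
  by (simp add: iter_def sarah_iter_def start_def)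

lemma iter_Suc: "iter s (Suc t) J = iter s t J - \<eta> *\<^sub>R dir s t J"
  by (simp add: iter_def sarah_iter_def dir_def start_def curry_def)

lemma iter_end: "s \<ge> 1 \<Longrightarrow> iter s (Suc m) J = start s J"
  by (cases s) (simp_all add: iter_def sarah_iter_def start_def)

lemma err_0: "err s 0 J = 0"
  by (simp add: err_def dir_def iter_0 grad_F)

text \<open>The new batch occurs only as the index set of the first sum. The gradient differences
  involve iterates up to \<open>t + 1\<close>, which the earlier draws determine, so the increment
  is a pure sampling error.\<close>

lemma err_Suc:
  "err s (Suc t) J = err s t J
    + (1 / real b) *\<^sub>R (\<Sum>i\<in>J (s, Suc t). grad (f i) (iter s (Suc t) J) - grad (f i) (iter s t J))
    - (1 / real n) *\<^sub>R (\<Sum>i\<in>{1..n}. grad (f i) (iter s (Suc t) J) - grad (f i) (iter s t J))"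
proof -
  have "dir s (Suc t) J = (1 / real b) *\<^sub>R
      (\<Sum>i\<in>J (s, Suc t). grad (f i) (iter s (Suc t) J) - grad (f i) (iter s t J)) + dir s t J"
    by (simp add: dir_def iter_def sarah_iter_def start_def curry_def)
  then show ?thesis
    by (simp add: err_def grad_F sum_subtractf scaleR_right_diff_distrib)
qed

lemma past_cong:
  assumes "\<And>i. i \<in> past s t \<Longrightarrow> J i = J' i"
  shows "iter s t J = iter s t J' \<and> iter s (Suc t) J = iter s (Suc t) J' \<and> dir s t J = dir s t J'"
proof -
  have "start (s - 1) J = start (s - 1) J'"
    unfolding start_def curry_def by (intro sarah_outer_cong assms) (auto simp: past_def)
  moreover have "curry J s r = curry J' s r" if "r \<in> {1..t}" for r
    using assms that by (auto simp: past_def)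
  ultimately show ?thesis
    using sarah_cong[of t "curry J s" "curry J' s" n f \<eta> b]
    by (simp add: iter_def dir_def sarah_iter_def start_def)
qed

lemma determined_by_past:
  "determined_by (past s t) (iter s t)"
  "determined_by (past s t) (iter s (Suc t))"
  "determined_by (past s t) (dir s t)"
  "determined_by (past s t) (err s t)"
  unfolding determined_by_def err_def using past_cong by metis+

lemma draws_random_variable:
  assumes "i \<in> {1..S} \<times> {1..m}"
  shows "random_variable (count_space (batches n b)) (\<lambda>\<omega>. draws \<omega> i)"
  using unif assms by (auto simp: uniform_batches_def indep_vars_def draws_def)

lemma integrable_past:
  fixes h :: "_ \<Rightarrow> real"
  assumes "determined_by (past s t) h" "s \<in> {1..S}" "t \<le> m"
  shows "integrable M (\<lambda>\<omega>. h (draws \<omega>))"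
  using integrable_determined_by[OF assms(1) finite_past finite_batches[of n b], of "\<lambda>i \<omega>. draws \<omega> i"]
    draws_random_variable past_subset[OF assms(2,3)] by auto

lemma integrable_norms:
  assumes "s \<in> {1..S}" "t \<le> m"
  shows "integrable M (\<lambda>\<omega>. (norm (err s t (draws \<omega>)))\<^sup>2)"
    and "integrable M (\<lambda>\<omega>. (norm (dir s t (draws \<omega>)))\<^sup>2)"
    and "integrable M (\<lambda>\<omega>. (norm (grad F (iter s t (draws \<omega>))))\<^sup>2)"
    and "integrable M (\<lambda>\<omega>. F (iter s t (draws \<omega>)))"
    and "integrable M (\<lambda>\<omega>. F (iter s (Suc t) (draws \<omega>)))"
  by (intro integrable_past[OF _ assms] determined_by_comp[OF determined_by_past(4), where \<phi> = "\<lambda>x. (norm x)\<^sup>2"]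
    determined_by_comp[OF determined_by_past(3), where \<phi> = "\<lambda>x. (norm x)\<^sup>2"]
    determined_by_comp[OF determined_by_past(1), where \<phi> = "\<lambda>x. (norm (grad F x))\<^sup>2"]
    determined_by_comp[OF determined_by_past(1), where \<phi> = F]
    determined_by_comp[OF determined_by_past(2), where \<phi> = F])+

section \<open>Expected error growth and expected descent\<close>

definition \<kappa> :: real where
  "\<kappa> = 1 / real b * ((real n - real b) / (real n - 1)) * (L\<^sup>2 * \<eta>\<^sup>2)"

lemma expectation_err_Suc:
  assumes s: "s \<in> {1..S}" and t: "t < m"
  shows "expectation (\<lambda>\<omega>. (norm (err s (Suc t) (draws \<omega>)))\<^sup>2)
    \<le> expectation (\<lambda>\<omega>. (norm (err s t (draws \<omega>)))\<^sup>2)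
      + \<kappa> * expectation (\<lambda>\<omega>. (norm (dir s t (draws \<omega>)))\<^sup>2)"
proof -
  define a where "a i J = grad (f i) (iter s (Suc t) J) - grad (f i) (iter s t J)" for i J
  \<comment> \<open>\<open>g\<close> separates the two roles of the draws: \<open>J\<close> supplies
    the past, \<open>C\<close> the batch of step \<open>t + 1\<close>, over which the average is
    taken.\<close>
  define g where "g J C = (norm (err s t J + (1 / real b) *\<^sub>R (\<Sum>i\<in>C. a i J)
      - (1 / real n) *\<^sub>R (\<Sum>i\<in>{1..n}. a i J)))\<^sup>2" for J C
  have g: "determined_by (past s t) (\<lambda>J. g J C)" for C
  proof (rule determined_byI)
    fix J J' :: "nat \<times> nat \<Rightarrow> nat set" assume "\<And>i. i \<in> past s t \<Longrightarrow> J i = J' i"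
    from past_cong[OF this] show "g J C = g J' C"
      by (simp add: g_def a_def err_def)
  qed
  have "expectation (\<lambda>\<omega>. (norm (err s (Suc t) (draws \<omega>)))\<^sup>2)
      = expectation (\<lambda>\<omega>. g (draws \<omega>) ((\<lambda>(s, t). I s t) (s, Suc t) \<omega>))"
    by (simp add: err_Suc g_def a_def draws_def)
  also have "\<dots> = expectation (\<lambda>\<omega>. (\<Sum>C\<in>batches n b. g (draws \<omega>) C) / real (card (batches n b)))"
    unfolding draws_def
  proof (rule expectation_average_indep[where A = "past s t" and K = "{1..S} \<times> {1..m}"])
    show "past s t \<subseteq> {1..S} \<times> {1..m}" using s t by (intro past_subset) auto
    show "(s, Suc t) \<in> {1..S} \<times> {1..m}" using s t by auto
    show "distr M (count_space (batches n b)) ((\<lambda>(s, t). I s t) (s, Suc t)) = uniform_count_measure (batches n b)"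
      using unif s t by (auto simp: uniform_batches_def)
  qed (use unif g in \<open>auto simp: uniform_batches_def finite_past finite_batches past_def\<close>)
  also have "\<dots> \<le> expectation (\<lambda>\<omega>. (norm (err s t (draws \<omega>)))\<^sup>2 + \<kappa> * (norm (dir s t (draws \<omega>)))\<^sup>2)"
  proof (rule integral_mono)
    have "determined_by (past s t) (\<lambda>J. (\<Sum>C\<in>batches n b. g J C) / real (card (batches n b)))"
      using g unfolding determined_by_def by (metis (no_types, lifting) sum.cong)
    then show "integrable M (\<lambda>\<omega>. (\<Sum>C\<in>batches n b. g (draws \<omega>) C) / real (card (batches n b)))"
      using s t by (intro integrable_past) auto
    show "integrable M (\<lambda>\<omega>. (norm (err s t (draws \<omega>)))\<^sup>2 + \<kappa> * (norm (dir s t (draws \<omega>)))\<^sup>2)"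
      using integrable_norms(1,2)[of s t] s t by auto
    fix \<omega>
    let ?J = "draws \<omega>"
    have "(\<Sum>C\<in>batches n b. g ?J C) / real (card (batches n b)) \<le> (norm (err s t ?J))\<^sup>2
        + 1 / real b * ((real n - real b) / (real n - 1)) * (1 / real n * (\<Sum>i\<in>{1..n}. (norm (a i ?J))\<^sup>2))"
      unfolding g_def by (rule batch_estimator_mse[OF n b])
    also have "\<dots> \<le> (norm (err s t ?J))\<^sup>2
        + 1 / real b * ((real n - real b) / (real n - 1)) * (L\<^sup>2 * (norm (iter s (Suc t) ?J - iter s t ?J))\<^sup>2)"
    proof (intro add_left_mono mult_left_mono)
      show "1 / real n * (\<Sum>i\<in>{1..n}. (norm (a i ?J))\<^sup>2) \<le> L\<^sup>2 * (norm (iter s (Suc t) ?J - iter s t ?J))\<^sup>2"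
        using smooth unfolding avg_smooth_def a_def by blast
    qed (use n b in auto)
    \<comment> \<open>Consecutive iterates differ by \<open>\<eta>\<close> times the direction,
      which turns the coefficient into \<open>\<kappa>\<close>.\<close>
    also have "\<dots> = (norm (err s t ?J))\<^sup>2 + \<kappa> * (norm (dir s t ?J))\<^sup>2"
      by (simp add: iter_Suc power_mult_distrib \<kappa>_def)
    finally show "(\<Sum>C\<in>batches n b. g ?J C) / real (card (batches n b))
        \<le> (norm (err s t ?J))\<^sup>2 + \<kappa> * (norm (dir s t ?J))\<^sup>2" .
  qed
  also have "\<dots> = expectation (\<lambda>\<omega>. (norm (err s t (draws \<omega>)))\<^sup>2)
      + \<kappa> * expectation (\<lambda>\<omega>. (norm (dir s t (draws \<omega>)))\<^sup>2)"
    using integrable_norms(1,2)[of s t] s t by simp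
  finally show ?thesis .
qed

text \<open>Pointwise in the draws: the descent lemma along \<open>- \<eta>\<close> times the
  direction, with the inner product of gradient and direction eliminated through the expansion of
  the squared error.\<close>

lemma descent_step:
  "F (iter s (Suc t) J) \<le> F (iter s t J) - \<eta> / 2 * (norm (grad F (iter s t J)))\<^sup>2
    + \<eta> / 2 * (norm (err s t J))\<^sup>2 - \<eta> / 2 * (1 - L * \<eta>) * (norm (dir s t J))\<^sup>2"
proof -
  let ?w = "iter s t J" and ?v = "dir s t J"
  have "GDERIV F w :> grad F w" for w
    unfolding grad_F by (intro GDERIV_avg_fun diff)
  moreover have "norm (grad F x - grad F y) \<le> L * norm (x - y)" for x y
    using n by (intro grad_avg_fun_lipschitz diff smooth) auto
  ultimately have "F (iter s (Suc t) J) \<le> F ?w + inner (grad F ?w) (iter s (Suc t) J - ?w)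
      + L / 2 * (norm (iter s (Suc t) J - ?w))\<^sup>2"
    by (rule descent_lemma)
  also have "\<dots> = F ?w - \<eta> * inner (grad F ?w) ?v + L / 2 * \<eta>\<^sup>2 * (norm ?v)\<^sup>2"
    by (simp add: iter_Suc power_mult_distrib)
  also have "\<dots> = F ?w - \<eta> / 2 * (norm (grad F ?w))\<^sup>2
      + \<eta> / 2 * (norm (err s t J))\<^sup>2 - \<eta> / 2 * (1 - L * \<eta>) * (norm ?v)\<^sup>2"
  proof -
    have *: "(norm (err s t J))\<^sup>2 = (norm ?v)\<^sup>2 - 2 * inner (grad F ?w) ?v + (norm (grad F ?w))\<^sup>2"
      by (simp add: err_def power2_norm_eq_inner inner_diff inner_commute)
    show ?thesis unfolding * by (simp add: field_simps power2_eq_square)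
  qed
  finally show ?thesis .
qed

text \<open>Expectations of \<open>descent_step\<close> and \<open>expectation_err_Suc\<close> feed
  \<open>sum_gradients_le\<close> with \<open>\<delta> = 1 - L * \<eta>\<close>. The telescoped
  ends, iterates \<open>0\<close> and \<open>m + 1\<close>, are the points between which outer loop
  \<open>s\<close> moves.\<close>

lemma inner_loop_bound:
  assumes s: "s \<in> {1..S}" and step: "real m * \<kappa> \<le> 1 - L * \<eta>"
  shows "(\<Sum>t = 0..m. expectation (\<lambda>\<omega>. (norm (grad F (iter s t (draws \<omega>))))\<^sup>2))
    \<le> 2 / \<eta> * (expectation (\<lambda>\<omega>. F (start (s - 1) (draws \<omega>))) - expectation (\<lambda>\<omega>. F (start s (draws \<omega>))))"
proof -
  have "0 \<le> \<kappa>" using n b by (simp add: \<kappa>_def)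
  moreover have "expectation (\<lambda>\<omega>. F (iter s (Suc t) (draws \<omega>)))
      \<le> expectation (\<lambda>\<omega>. F (iter s t (draws \<omega>)))
        - \<eta> / 2 * expectation (\<lambda>\<omega>. (norm (grad F (iter s t (draws \<omega>))))\<^sup>2)
        + \<eta> / 2 * expectation (\<lambda>\<omega>. (norm (err s t (draws \<omega>)))\<^sup>2)
        - \<eta> / 2 * (1 - L * \<eta>) * expectation (\<lambda>\<omega>. (norm (dir s t (draws \<omega>)))\<^sup>2)" if "t \<le> m" for t
  proof -
    note int = integrable_norms[OF s that]
    have "expectation (\<lambda>\<omega>. F (iter s (Suc t) (draws \<omega>)))
      \<le> expectation (\<lambda>\<omega>. F (iter s t (draws \<omega>)) - \<eta> / 2 * (norm (grad F (iter s t (draws \<omega>))))\<^sup>2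
        + \<eta> / 2 * (norm (err s t (draws \<omega>)))\<^sup>2 - \<eta> / 2 * (1 - L * \<eta>) * (norm (dir s t (draws \<omega>)))\<^sup>2)"
      by (intro integral_mono descent_step Bochner_Integration.integrable_diff
          Bochner_Integration.integrable_add integrable_mult_right int)
    also have "\<dots> = expectation (\<lambda>\<omega>. F (iter s t (draws \<omega>)))
        - \<eta> / 2 * expectation (\<lambda>\<omega>. (norm (grad F (iter s t (draws \<omega>))))\<^sup>2)
        + \<eta> / 2 * expectation (\<lambda>\<omega>. (norm (err s t (draws \<omega>)))\<^sup>2)
        - \<eta> / 2 * (1 - L * \<eta>) * expectation (\<lambda>\<omega>. (norm (dir s t (draws \<omega>)))\<^sup>2)"
      by (simp only: Bochner_Integration.integral_diff Bochner_Integration.integral_add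
          integral_mult_right_zero Bochner_Integration.integrable_diff
          Bochner_Integration.integrable_add integrable_mult_right int)
    finally show ?thesis .
  qed
  ultimately have "(\<Sum>t = 0..m. expectation (\<lambda>\<omega>. (norm (grad F (iter s t (draws \<omega>))))\<^sup>2))
    \<le> 2 / \<eta> * (expectation (\<lambda>\<omega>. F (iter s 0 (draws \<omega>))) - expectation (\<lambda>\<omega>. F (iter s (Suc m) (draws \<omega>))))"
    using step \<eta> s
    by (intro sum_gradients_le[where \<kappa> = \<kappa> and \<delta> = "1 - L * \<eta>"
          and E = "\<lambda>t. expectation (\<lambda>\<omega>. (norm (err s t (draws \<omega>)))\<^sup>2)"
          and V = "\<lambda>t. expectation (\<lambda>\<omega>. (norm (dir s t (draws \<omega>)))\<^sup>2)"] expectation_err_Suc)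
      (auto simp: err_0)
  then show ?thesis using s by (simp add: iter_0 iter_end)
qed

lemma outer_loop_bound:
  assumes S: "S \<ge> 1" and step: "real m * \<kappa> \<le> 1 - L * \<eta>" and lb: "\<And>w. Fstar \<le> F w"
  shows "(\<Sum>s = 1..S. \<Sum>t = 0..m. expectation (\<lambda>\<omega>. (norm (grad F (iter s t (draws \<omega>))))\<^sup>2))
    \<le> 2 / \<eta> * (F w0 - Fstar)"
proof -
  define \<Phi> where "\<Phi> s = expectation (\<lambda>\<omega>. F (start s (draws \<omega>)))" for s
  have "(\<Sum>s = 1..S. \<Sum>t = 0..m. expectation (\<lambda>\<omega>. (norm (grad F (iter s t (draws \<omega>))))\<^sup>2))
      \<le> (\<Sum>s = 1..S. 2 / \<eta> * (\<Phi> (s - 1) - \<Phi> s))"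
    unfolding \<Phi>_def by (intro sum_mono inner_loop_bound step)
  also have "\<dots> = 2 / \<eta> * (\<Sum>s<S. \<Phi> s - \<Phi> (Suc s))"
    unfolding sum_distrib_left
    by (rule sum.reindex_bij_witness[where i = Suc and j = "\<lambda>s. s - 1"]) auto
  also have "(\<Sum>s<S. \<Phi> s - \<Phi> (Suc s)) = \<Phi> 0 - \<Phi> S"
    by (rule sum_lessThan_telescope')
  also have "2 / \<eta> * (\<Phi> 0 - \<Phi> S) \<le> 2 / \<eta> * (F w0 - Fstar)"
  proof (intro mult_left_mono diff_mono)
    show "\<Phi> 0 \<le> F w0" by (simp add: \<Phi>_def start_def prob_space)
    \<comment> \<open>The returned point is iterate \<open>m + 1\<close> of loop \<open>S\<close>,
      hence a function of finitely many draws.\<close>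
    have "integrable M (\<lambda>\<omega>. F (start S (draws \<omega>)))"
      using integrable_norms(5)[of S m] S by (simp add: iter_end)
    then show "Fstar \<le> \<Phi> S"
      unfolding \<Phi>_def using lb by (intro integral_ge_const) auto
  qed (use \<eta> in auto)
  finally show ?thesis .
qed

end

theorem theorem2:
  fixes f :: "nat \<Rightarrow> real ^ 'd \<Rightarrow> real"
    and L \<eta> Fstar :: real
    and n b m S :: nat
    and w0 :: "real ^ 'd"
    and M :: "'z measure"
    and I :: "nat \<Rightarrow> nat \<Rightarrow> 'z \<Rightarrow> nat set"
  assumes "n \<ge> 2"
    and "\<And>i w. i \<in> {1..n} \<Longrightarrow> f i differentiable (at w)"
    and "avg_smooth L n f"
    and "\<And>w. Fstar \<le> avg_fun n f w"
    and "1 \<le> b" and "b \<le> n" and "S \<ge> 1"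
    and "0 < \<eta>"
    and "\<eta> \<le> 2 / (L * (sqrt (1 + 4 * real m / real b * ((real n - real b) / (real n - 1))) + 1))"
    and "prob_space M"
    and "uniform_batches M n b m S I"
  shows "1 / ((real m + 1) * real S) *
           (\<Sum>s = 1..S. \<Sum>t = 0..m.
              (\<integral>\<omega>. (norm (grad (avg_fun n f)
                     (sarah_iter n f \<eta> b m (\<lambda>s t. I s t \<omega>) w0 s t)))\<^sup>2 \<partial>M))
         \<le> 2 / (\<eta> * ((real m + 1) * real S)) * (avg_fun n f w0 - Fstar)"
proof -
  interpret sarah_run M f L \<eta> n b m S w0 I
    using assms by (intro sarah_run.intro sarah_run_axioms.intro)
  \<comment> \<open>Chosen so that \<open>real m * \<kappa>\<close> equals \<open>c\<close> times
    the square of \<open>L * \<eta>\<close>. Multiplied by \<open>L\<close>, the step size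
    hypothesis then becomes the premise of \<open>step_size_bound\<close>.\<close>
  define c where "c = real m * (1 / real b * ((real n - real b) / (real n - 1)))"
  define X where "X = (\<Sum>s = 1..S. \<Sum>t = 0..m.
              (\<integral>\<omega>. (norm (grad (avg_fun n f)
                     (sarah_iter n f \<eta> b m (\<lambda>s t. I s t \<omega>) w0 s t)))\<^sup>2 \<partial>M))"
  have L: "L > 0" using smooth by (simp add: avg_smooth_def)
  have c0: "0 \<le> c" using n b by (simp add: c_def)
  have "sqrt (1 + 4 * c) + 1 > 0" using c0 by (simp add: add_nonneg_pos)
  moreover have "\<eta> \<le> 2 / (L * (sqrt (1 + 4 * c) + 1))"
    using assms(9) by (simp add: c_def mult.assoc)
  ultimately have "L * \<eta> \<le> 2 / (sqrt (1 + 4 * c) + 1)"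
    using L by (simp add: pos_le_divide_eq mult_ac)
  then have "c * (L * \<eta>)\<^sup>2 \<le> 1 - L * \<eta>"
    using L \<eta> c0 by (intro step_size_bound) auto
  then have step: "real m * \<kappa> \<le> 1 - L * \<eta>"
    by (simp add: c_def \<kappa>_def power_mult_distrib mult_ac)
  have "sarah_iter n f \<eta> b m (\<lambda>s t. I s t \<omega>) w0 s t = iter s t (draws \<omega>)" for s t \<omega>
    by (simp add: iter_def draws_def curry_def)
  then have "X \<le> 2 / \<eta> * (avg_fun n f w0 - Fstar)"
    unfolding X_def using outer_loop_bound[OF assms(7) step assms(4)] by simp
  then have "1 / ((real m + 1) * real S) * X
      \<le> 1 / ((real m + 1) * real S) * (2 / \<eta> * (avg_fun n f w0 - Fstar))"
    by (intro mult_left_mono) auto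
  then show ?thesis unfolding X_def by (simp add: mult_ac)
qed

end
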